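(* Let $(\mathcal{L},[\cdot,\cdot],\alpha)$ and $(\mathcal{L}',[\cdot,\cdot]',\alpha')$ be multiplicative Hom-Lie algebras over $\mathbb{K}$, $\phi:\mathcal{L}\to\mathcal{L}'$ a Hom-Lie algebra morphism and $\Theta_t=([\cdot,\cdot]_t,[\cdot,\cdot]'_t,\phi_t)$ a deformation of $\phi$. Then its linear coefficient $\theta_1=([\cdot,\cdot]_1,[\cdot,\cdot]'_1,\phi_1)$, called the infinitesimal of the deformation $\Theta_t$, is a $2$-cocycle in $C^2_{HL}(\phi,\phi)$.
   Context: $\mathbb{K}$ is an algebraically closed field of characteristic $0$. A Hom-Lie algebra $(\mathcal{L},[\cdot,\cdot],\alpha)$ is a vector space with a skew-symmetric bilinear bracket and a linear map $\alpha$ such that $[\alpha(x),[y,z]]+[\alpha(y),[z,x]]+[\alpha(z),[x,y]]=0$ (Hom-Jacobi identity); it is multiplicative if $\alpha([x,y])=[\alpha(x),\alpha(y)]$. A Hom-Lie algebra morphism is a linear map $\phi$ with $[\phi(x),\phi(y)]'=\phi([x,y])$ and $\phi\circ\alpha=\alpha'\circ\phi$. Deformations: a (one-parameter formal) deformation of $(\mathcal{L},[\cdot,\cdot],\alpha)$ is a $\mathbb{K}[[t]]$-bilinear bracket $[\cdot,\cdot]_t=\sum_{i\ge0}t^i[\cdot,\cdot]_i$ on $\mathcal{L}[[t]]$, with $[\cdot,\cdot]_i:\mathcal{L}\times\mathcal{L}\to\mathcal{L}$ bilinear and $[\cdot,\cdot]_0=[\cdot,\cdot]$, which is skew-symmetric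 and satisfies the Hom-Jacobi identity with respect to $\alpha$; similarly for $\mathcal{L}'$ (with $\alpha'$). A deformation of $\phi$ is a triple $([\cdot,\cdot]_t,[\cdot,\cdot]'_t,\phi_t)$ consisting of deformations of $\mathcal{L}$ and $\mathcal{L}'$ and a Hom-Lie algebra morphism $\phi_t=\sum_{n\ge0}\phi_nt^n:\mathcal{L}[[t]]\to\mathcal{L}'[[t]]$ with each $\phi_n:\mathcal{L}\to\mathcal{L}'$ linear and $\phi_0=\phi$. Cohomology: for $n\ge1$, $\widetilde{C}^n_{\alpha,\alpha'}(\mathcal{L},\mathcal{L}')$ is the space of skew-symmetric $n$-linear maps $f:\mathcal{L}^{\times n}\to\mathcal{L}'$ with $\alpha'(f(u_1,\dots,u_n))=f(\alpha(u_1),\dots,\alpha(u_n))$, with $$\delta^n_{HL}\varphi(x_0,\dots,x_n)=\sum_{i=0}^n(-1)^i[\phi(\alpha^{n-1}(x_i)),\varphi(x_0,\dots,\widehat{x_i},\dots,x_n)]'+\sum_{0\le i<j\le n}(-1)^{i+j}\varphi([x_i,x_j],\alpha(x_0),\dots,\widehat{x_i},\dots,\widehat{x_j},\dots,\alpha(x_n)).$$ $C^n_{HL}(\mathcal{L},\mathcal{L})$ and $C^n_{HL}(\mathcal{L}',\mathcal{L}')$ with their $\delta^n_{HL}$ are the cases where $\phi$ is the identity of $\mathcal{L}$, respectively of $\mathcal{L}'$. For $n\ge2$, $C^n_{HL}(\phi,\phi)=C^n_{HL}(\mathcal{L},\mathcal{L})\times C^n_{HL}(\mathcal{L}',\mathcal{L}')\times\widetilde{C}^{n-1}_{\alpha,\alpha'}(\mathcal{L},\mathcal{L}')$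 and $\delta^n(\varphi_1,\varphi_2,\varphi_3)=(\delta^n_{HL}\varphi_1,\delta^n_{HL}\varphi_2,\delta^{n-1}_{HL}\varphi_3+(-1)^{n-1}(\phi\circ\varphi_1-\varphi_2\diamond\phi))$, where $(\varphi_2\diamond\phi)(x_1,\dots,x_n)=\varphi_2(\phi(x_1),\dots,\phi(x_n))$. A $2$-cocycle in $C^2_{HL}(\phi,\phi)$ is an element annihilated by $\delta^2$.
   Formalization: As deformed brackets need not be multiplicative, [·,·]_1 and [·,·]'_1 may fail to commute with α, α'; membership in C^2_HL(φ,φ) is proved for multiplicative deformed brackets, while skew-bilinearity, φ_1 in the cochain space, and δ^2θ_1=0 are proved always. *)

theory Defs
  imports "HOL-Computational_Algebra.Computational_Algebra"
begin

section \<open>Hom-Lie algebras\<close>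

text \<open>The underlying space of a structure is the whole type \<open>'a\<close>. The scalars are only required to
  form a commutative ring, so that the same notions apply to \<open>\<L>\<close> over the field \<open>\<K>\<close> (where
  \<^locale>\<open>module\<close> is the same as \<^locale>\<open>vector_space\<close>) and to \<open>\<L>[[t]]\<close> over \<open>\<K>[[t]]\<close>.\<close>

record ('k, 'a) hom_lie =
  smul :: "'k \<Rightarrow> 'a \<Rightarrow> 'a"
  brk :: "'a \<Rightarrow> 'a \<Rightarrow> 'a"
  twist :: "'a \<Rightarrow> 'a"

definition bilinear_map ::
  "('k::comm_ring_1 \<Rightarrow> 'a::ab_group_add \<Rightarrow> 'a) \<Rightarrow> ('a \<Rightarrow> 'a \<Rightarrow> 'a) \<Rightarrow> bool" where
  "bilinear_map s b \<longleftrightarrow>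
     (\<forall>x. module_hom s s (b x)) \<and> (\<forall>y. module_hom s s (\<lambda>x. b x y))"

definition hom_lie_algebra :: "('k::comm_ring_1, 'a::ab_group_add) hom_lie \<Rightarrow> bool" where
  "hom_lie_algebra L \<longleftrightarrow>
     module (smul L) \<and>
     bilinear_map (smul L) (brk L) \<and>
     module_hom (smul L) (smul L) (twist L) \<and>
     (\<forall>x y. brk L x y = - brk L y x) \<and>
     (\<forall>x y z. brk L (twist L x) (brk L y z) + brk L (twist L y) (brk L z x)
              + brk L (twist L z) (brk L x y) = 0)"

definition multiplicative :: "('k, 'a) hom_lie \<Rightarrow> bool" where
  "multiplicative L \<longleftrightarrow> (\<forall>x y. twist L (brk L x y) = brk L (twist L x) (twist L y))"

definition hom_lie_morphism ::
  "('k::comm_ring_1, 'a::ab_group_add) hom_lie \<Rightarrow> ('k, 'b::ab_group_add) hom_lie \<Rightarrow>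
   ('a \<Rightarrow> 'b) \<Rightarrow> bool" where
  "hom_lie_morphism L L' \<phi> \<longleftrightarrow>
     module_hom (smul L) (smul L') \<phi> \<and>
     (\<forall>x y. brk L' (\<phi> x) (\<phi> y) = \<phi> (brk L x y)) \<and>
     \<phi> \<circ> twist L = twist L' \<circ> \<phi>"


section \<open>Formal deformations\<close>

text \<open>\<open>\<L>[[t]]\<close> is the type \<^typ>\<open>'a fps\<close>. A family of bilinear maps \<open>B i\<close> stands for the
  \<open>\<K>[[t]]\<close>-bilinear extension of \<open>\<Sum>\<^sub>i t\<^sup>i B i\<close>, and a family of linear maps \<open>\<Phi> i\<close> for the
  \<open>\<K>[[t]]\<close>-linear extension of \<open>\<Sum>\<^sub>i t\<^sup>i \<Phi> i\<close>.\<close>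

definition fps_smul ::
  "('k::zero \<Rightarrow> 'a::ab_group_add \<Rightarrow> 'a) \<Rightarrow> 'k fps \<Rightarrow> 'a fps \<Rightarrow> 'a fps" where
  "fps_smul s c x = Abs_fps (\<lambda>n. \<Sum>i\<le>n. s (fps_nth c i) (fps_nth x (n - i)))"

definition fps_bilinear_ext ::
  "(nat \<Rightarrow> 'a::ab_group_add \<Rightarrow> 'a \<Rightarrow> 'a) \<Rightarrow> 'a fps \<Rightarrow> 'a fps \<Rightarrow> 'a fps" where
  "fps_bilinear_ext B x y =
     Abs_fps (\<lambda>n. \<Sum>k\<le>n. \<Sum>i\<le>n - k. B k (fps_nth x i) (fps_nth y (n - k - i)))"

definition fps_linear_ext ::
  "(nat \<Rightarrow> 'a::ab_group_add \<Rightarrow> 'b::ab_group_add) \<Rightarrow> 'a fps \<Rightarrow> 'b fps" where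
  "fps_linear_ext \<Phi> x = Abs_fps (\<lambda>n. \<Sum>k\<le>n. \<Phi> k (fps_nth x (n - k)))"

definition fps_hom_lie ::
  "('k::comm_ring_1, 'a::ab_group_add) hom_lie \<Rightarrow> (nat \<Rightarrow> 'a \<Rightarrow> 'a \<Rightarrow> 'a) \<Rightarrow>
   ('k fps, 'a fps) hom_lie" where
  "fps_hom_lie L B =
     \<lparr> smul = fps_smul (smul L),
       brk = fps_bilinear_ext B,
       twist = (\<lambda>x. Abs_fps (\<lambda>n. twist L (fps_nth x n))) \<rparr>"

text \<open>Multiplicativity of the deformed structure is not part of the definition, and it does not follow
  from multiplicativity of \<open>L\<close>. Hence the coefficient \<open>B 1\<close> of a deformation need not commute with
  the twist map, although it is always skew-symmetric and bilinear.\<close>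

definition deformation ::
  "('k::comm_ring_1, 'a::ab_group_add) hom_lie \<Rightarrow> (nat \<Rightarrow> 'a \<Rightarrow> 'a \<Rightarrow> 'a) \<Rightarrow> bool" where
  "deformation L B \<longleftrightarrow>
     (\<forall>i. bilinear_map (smul L) (B i)) \<and> B 0 = brk L \<and> hom_lie_algebra (fps_hom_lie L B)"

definition morphism_deformation ::
  "('k::comm_ring_1, 'a::ab_group_add) hom_lie \<Rightarrow> ('k, 'b::ab_group_add) hom_lie \<Rightarrow>
   ('a \<Rightarrow> 'b) \<Rightarrow> (nat \<Rightarrow> 'a \<Rightarrow> 'a \<Rightarrow> 'a) \<Rightarrow> (nat \<Rightarrow> 'b \<Rightarrow> 'b \<Rightarrow> 'b) \<Rightarrow> (nat \<Rightarrow> 'a \<Rightarrow> 'b) \<Rightarrow> bool"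
  where
  "morphism_deformation L L' \<phi> B B' \<Phi> \<longleftrightarrow>
     deformation L B \<and> deformation L' B' \<and>
     (\<forall>n. module_hom (smul L) (smul L') (\<Phi> n)) \<and> \<Phi> 0 = \<phi> \<and>
     hom_lie_morphism (fps_hom_lie L B) (fps_hom_lie L' B') (fps_linear_ext \<Phi>)"


section \<open>Cohomology\<close>

text \<open>A map \<open>\<L>\<^sup>n \<rightarrow> \<L>'\<close> is encoded as a function on lists that vanishes on all lists of length
  other than \<open>n\<close>, so that equality of cochains is equality of functions.\<close>

definition skew_multilinear ::
  "('k::comm_ring_1, 'a::ab_group_add) hom_lie \<Rightarrow> ('k, 'b::ab_group_add) hom_lie \<Rightarrow> nat \<Rightarrow>
   ('a list \<Rightarrow> 'b) set" where
  "skew_multilinear L L' n =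
     {f. (\<forall>xs. length xs \<noteq> n \<longrightarrow> f xs = 0) \<and>
         (\<forall>xs i. length xs = n \<longrightarrow> i < n \<longrightarrow>
            module_hom (smul L) (smul L') (\<lambda>x. f (xs[i := x]))) \<and>
         (\<forall>xs i j. length xs = n \<longrightarrow> i < n \<longrightarrow> j < n \<longrightarrow> i \<noteq> j \<longrightarrow>
            f (xs[i := xs ! j, j := xs ! i]) = - f xs)}"

definition cochains ::
  "('k::comm_ring_1, 'a::ab_group_add) hom_lie \<Rightarrow> ('k, 'b::ab_group_add) hom_lie \<Rightarrow> nat \<Rightarrow>
   ('a list \<Rightarrow> 'b) set" where
  "cochains L L' n =
     {f \<in> skew_multilinear L L' n.
        \<forall>xs. length xs = n \<longrightarrow> twist L' (f xs) = f (map (twist L) xs)}"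

text \<open>\<^term>\<open>nths xs (- {i})\<close> is the list \<open>xs\<close> with the entry at position \<open>i\<close> omitted.\<close>

definition delta_HL ::
  "('k::comm_ring_1, 'a::ab_group_add) hom_lie \<Rightarrow> ('k, 'b::ab_group_add) hom_lie \<Rightarrow>
   ('a \<Rightarrow> 'b) \<Rightarrow> nat \<Rightarrow> ('a list \<Rightarrow> 'b) \<Rightarrow> 'a list \<Rightarrow> 'b" where
  "delta_HL L L' \<phi> n f xs =
     (if length xs = Suc n then
        (\<Sum>i\<le>n. smul L' ((-1) ^ i)
           (brk L' (\<phi> ((twist L ^^ (n - 1)) (xs ! i))) (f (nths xs (- {i}))))) +
        (\<Sum>j\<le>n. \<Sum>i<j. smul L' ((-1) ^ (i + j))
           (f (brk L (xs ! i) (xs ! j) # map (twist L) (nths xs (- {i, j})))))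
      else 0)"

type_synonym ('a, 'b) cochain_triple =
  "('a list \<Rightarrow> 'a) \<times> ('b list \<Rightarrow> 'b) \<times> ('a list \<Rightarrow> 'b)"

definition morphism_cochains ::
  "('k::comm_ring_1, 'a::ab_group_add) hom_lie \<Rightarrow> ('k, 'b::ab_group_add) hom_lie \<Rightarrow> nat \<Rightarrow>
   ('a, 'b) cochain_triple set" where
  "morphism_cochains L L' n = cochains L L n \<times> cochains L' L' n \<times> cochains L L' (n - 1)"

definition morphism_delta ::
  "('k::comm_ring_1, 'a::ab_group_add) hom_lie \<Rightarrow> ('k, 'b::ab_group_add) hom_lie \<Rightarrow>
   ('a \<Rightarrow> 'b) \<Rightarrow> nat \<Rightarrow> ('a, 'b) cochain_triple \<Rightarrow> ('a, 'b) cochain_triple" where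
  "morphism_delta L L' \<phi> n = (\<lambda>(f1, f2, f3).
     (delta_HL L L id n f1,
      delta_HL L' L' id n f2,
      (\<lambda>xs. delta_HL L L' \<phi> (n - 1) f3 xs
             + smul L' ((-1) ^ (n - 1)) (\<phi> (f1 xs) - f2 (map \<phi> xs)))))"

definition morphism_cocycles ::
  "('k::comm_ring_1, 'a::ab_group_add) hom_lie \<Rightarrow> ('k, 'b::ab_group_add) hom_lie \<Rightarrow>
   ('a \<Rightarrow> 'b) \<Rightarrow> nat \<Rightarrow> ('a, 'b) cochain_triple set" where
  "morphism_cocycles L L' \<phi> n =
     {\<theta> \<in> morphism_cochains L L' n.
        morphism_delta L L' \<phi> n \<theta> = (\<lambda>_. 0, \<lambda>_. 0, \<lambda>_. 0)}"

definition unary_cochain :: "('a \<Rightarrow> 'b) \<Rightarrow> 'a list \<Rightarrow> 'b::zero" where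
  "unary_cochain f xs = (case xs of [x] \<Rightarrow> f x | _ \<Rightarrow> 0)"

definition binary_cochain :: "('a \<Rightarrow> 'a \<Rightarrow> 'b) \<Rightarrow> 'a list \<Rightarrow> 'b::zero" where
  "binary_cochain b xs = (case xs of [x, y] \<Rightarrow> b x y | _ \<Rightarrow> 0)"

definition infinitesimal ::
  "(nat \<Rightarrow> 'a::zero \<Rightarrow> 'a \<Rightarrow> 'a) \<Rightarrow> (nat \<Rightarrow> 'b::zero \<Rightarrow> 'b \<Rightarrow> 'b) \<Rightarrow> (nat \<Rightarrow> 'a \<Rightarrow> 'b) \<Rightarrow>
   ('a, 'b) cochain_triple" where
  "infinitesimal B B' \<Phi> = (binary_cochain (B 1), binary_cochain (B' 1), unary_cochain (\<Phi> 1))"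

end

theory Submission
  imports Defs
begin

text \<open>Every identity needed is the coefficient of \<open>t\<close> of an identity in \<open>\<L>[[t]]\<close>, evaluated on
  constant series: the Hom-Jacobi identity gives \<open>\<delta> [\<cdot>,\<cdot>]\<^sub>1 = 0\<close> (for \<open>\<L>\<close> and \<open>\<L>'\<close>), and
  compatibility of \<open>\<phi>\<^sub>t\<close> with the brackets gives the vanishing of the third component.\<close>

lemma bilinear_map_zero:
  assumes "bilinear_map s b"
  shows "b x 0 = 0" and "b 0 y = 0"
  using assms module_hom.zero[of s s "b x"] module_hom.zero[of s s "\<lambda>x. b x y"]
  unfolding bilinear_map_def by auto

lemma bilinear_map_minus_right:
  assumes "bilinear_map s b"
  shows "b x (- y) = - b x y"
  using assms module_hom.neg[of s s "b x"]
  unfolding bilinear_map_def by auto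

lemma fps_bilinear_ext_nth_1:
  "fps_nth (fps_bilinear_ext B x y) 1 =
     B 0 (fps_nth x 0) (fps_nth y 1) + B 0 (fps_nth x 1) (fps_nth y 0)
     + B 1 (fps_nth x 0) (fps_nth y 0)"
  by (simp add: fps_bilinear_ext_def)

lemma hom_lie_algebraD:
  assumes "hom_lie_algebra L"
  shows "module (smul L)" and "bilinear_map (smul L) (brk L)"
    and "module_hom (smul L) (smul L) (twist L)"
    and "brk L x y = - brk L y x"
    and "brk L (twist L x) (brk L y z) + brk L (twist L y) (brk L z x)
       + brk L (twist L z) (brk L x y) = 0"
  using assms unfolding hom_lie_algebra_def by blast+

lemma fps_hom_lie_sel [simp]:
  "brk (fps_hom_lie L B) = fps_bilinear_ext B"
  "fps_nth (twist (fps_hom_lie L B) f) n = twist L (fps_nth f n)"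
  by (simp_all add: fps_hom_lie_def)

lemma deformationD:
  assumes "deformation L B"
  shows "bilinear_map (smul L) (B i)" and "B 0 = brk L" and "hom_lie_algebra (fps_hom_lie L B)"
  using assms by (simp_all add: deformation_def)

text \<open>The twist acts on series coefficientwise, so it sends constant series to constant series
  only because it kills 0. This is what allows evaluation on constants in the identities
  below.\<close>

lemma deformation_twist_zero:
  assumes "deformation L B"
  shows "twist L 0 = 0"
  using arg_cong[OF module_hom.zero[OF hom_lie_algebraD(3)[OF deformationD(3)[OF assms]]],
      of "\<lambda>f. fps_nth f 0"]
  by simp

lemma deformation_brk_1_skew:
  assumes "deformation L B"
  shows "B 1 x y = - B 1 y x"
proof -
  note hl = hom_lie_algebraD(4)[OF deformationD(3)[OF assms], unfolded fps_hom_lie_sel]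
  \<comment> \<open>On constant series the two \<open>B 0\<close> terms of the coefficient contain a
    zero argument and vanish; only \<open>B 1 x y\<close> survives.\<close>
  from arg_cong[OF hl, of "\<lambda>f. fps_nth f 1" "fps_const x" "fps_const y"] show ?thesis
    unfolding fps_neg_nth fps_bilinear_ext_nth_1
    by (simp add: bilinear_map_zero[OF deformationD(1)[OF assms]])
qed

lemma deformation_hom_jacobi_1:
  assumes "deformation L B"
  shows "B 1 (twist L x) (brk L y z) + B 1 (twist L y) (brk L z x) + B 1 (twist L z) (brk L x y)
     + brk L (twist L x) (B 1 y z) + brk L (twist L y) (B 1 z x) + brk L (twist L z) (B 1 x y) = 0"
proof -
  note bil = deformationD(1)[OF assms]
  let ?M = "fps_hom_lie L B"
  \<comment> \<open>In a nested bracket of constants the single factor t comes either from the inner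
    or from the outer bracket. The cyclic sum of these two contributions gives the six
    terms.\<close>
  have coeff: "fps_nth (fps_bilinear_ext B (twist ?M (fps_const x))
      (fps_bilinear_ext B (fps_const y) (fps_const z))) 1 =
      brk L (twist L x) (B 1 y z) + B 1 (twist L x) (brk L y z)" for x y z
    by (simp add: fps_bilinear_ext_def bilinear_map_zero[OF bil] deformation_twist_zero[OF assms]
        flip: deformationD(2)[OF assms])
  note hl = hom_lie_algebraD(5)[OF deformationD(3)[OF assms], unfolded fps_hom_lie_sel(1)]
  from arg_cong[OF hl, of "\<lambda>f. fps_nth f 1" "fps_const x" "fps_const y" "fps_const z"]
  show ?thesis
    unfolding fps_add_nth coeff by (simp add: algebra_simps)
qed

lemma binary_cochain_skew_multilinear:
  assumes "bilinear_map (smul L) b" and "\<And>x y. b x y = - b y x"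
  shows "binary_cochain b \<in> skew_multilinear L L 2"
proof -
  have "binary_cochain b xs = 0" if "length xs \<noteq> 2" for xs
    using that by (auto simp: binary_cochain_def split: list.splits)
  moreover have "module_hom (smul L) (smul L) (\<lambda>x. binary_cochain b (xs[i := x]))"
    if "length xs = 2" "i < 2" for xs i
    using that assms(1)
    by (auto simp: numeral_2_eq_2 length_Suc_conv less_Suc_eq binary_cochain_def bilinear_map_def)
  moreover have "binary_cochain b (xs[i := xs ! j, j := xs ! i]) = - binary_cochain b xs"
    if "length xs = 2" "i < 2" "j < 2" "i \<noteq> j" for xs i j
    using that
    by (auto simp: numeral_2_eq_2 length_Suc_conv less_Suc_eq binary_cochain_def intro: assms(2))
  ultimately show ?thesis
    by (simp add: skew_multilinear_def)
qed

text \<open>With one argument there are no two distinct positions to swap, so skew-symmetry is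
  vacuous; linearity and compatibility with the twists remain.\<close>

lemma unary_cochain_cochains:
  assumes "module_hom (smul L) (smul L') f" and "\<And>x. twist L' (f x) = f (twist L x)"
  shows "unary_cochain f \<in> cochains L L' 1"
  using assms
  by (auto simp: cochains_def skew_multilinear_def unary_cochain_def length_Suc_conv
      split: list.splits)

text \<open>Skew-symmetry of \<open>b\<close> and of the bracket absorbs all signs of the
  coboundary, which leaves the linearized Hom-Jacobi expression in cyclic form.\<close>

lemma delta_HL_binary_cochain:
  assumes "module (smul L)" and "bilinear_map (smul L) b" and skew: "\<And>x y. b x y = - b y x"
    and skewL: "\<And>x y. brk L x y = - brk L y x" and "bilinear_map (smul L) (brk L)"
  shows "delta_HL L L id 2 (binary_cochain b) [x, y, z] =
     b (twist L x) (brk L y z) + b (twist L y) (brk L z x) + b (twist L z) (brk L x y)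
     + brk L (twist L x) (b y z) + brk L (twist L y) (b z x) + brk L (twist L z) (b x y)"
proof -
  have neg: "smul L (-1) v = - v" "smul L 1 v = v" for v
    using assms(1) by (simp_all add: module.scale_minus_left module.scale_one)
  \<comment> \<open>The coboundary lists arguments in increasing order, so the pair (x, z) has to
    become the cyclic (z, x). Keeping x and z fixed makes these equations rewrite in one direction
    only.\<close>
  have "b (brk L u v) w = - b w (brk L u v)" "brk L u (b x z) = - brk L u (b z x)"
    "b w (brk L x z) = - b w (brk L z x)" for u v w
    using skew skewL bilinear_map_minus_right[OF assms(2)] bilinear_map_minus_right[OF assms(5)] by metis+
  then show ?thesis
    by (simp add: delta_HL_def numeral_2_eq_2 nths_Cons binary_cochain_def neg)
qed

text \<open>In degree 1 the twist occurs with exponent 0 and the second sum has no remaining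
  argument to twist. The result measures how far \<open>f\<close> is from being a derivation along
  \<phi>.\<close>

lemma delta_HL_unary_cochain:
  assumes "module (smul L')"
  shows "delta_HL L L' \<phi> 1 (unary_cochain f) [x, y] =
     brk L' (\<phi> x) (f y) - brk L' (\<phi> y) (f x) - f (brk L x y)"
proof -
  have neg: "smul L' (-1) v = - v" "smul L' 1 v = v" for v
    using assms by (simp_all add: module.scale_minus_left module.scale_one)
  show ?thesis
    by (simp add: delta_HL_def nths_Cons unary_cochain_def neg)
qed

lemma deformation_delta_HL:
  assumes "hom_lie_algebra L" and "deformation L B"
  shows "delta_HL L L id 2 (binary_cochain (B 1)) = (\<lambda>_. 0)"
proof
  fix xs :: "'b list"
  show "delta_HL L L id 2 (binary_cochain (B 1)) xs = 0"
  proof (cases "length xs = 3")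
    case True
    then obtain x y z where xs: "xs = [x, y, z]"
      by (auto simp: numeral_3_eq_3 length_Suc_conv)
    have "delta_HL L L id 2 (binary_cochain (B 1)) [x, y, z] = 0"
      unfolding delta_HL_binary_cochain[OF hom_lie_algebraD(1)[OF assms(1)] deformationD(1)[OF assms(2)]
          deformation_brk_1_skew[OF assms(2)] hom_lie_algebraD(4,2)[OF assms(1)]]
      by (rule deformation_hom_jacobi_1[OF assms(2)])
    then show ?thesis
      by (simp add: xs)
  qed (simp add: delta_HL_def)
qed

text \<open>In the bracket of two images the factor t comes from the bracket or from one of the two
  copies of the deformed morphism, hence three terms on the left. The second claim is the
  coefficient of t in the compatibility with the twists.\<close>

lemma morphism_deformation_1:
  assumes "morphism_deformation L L' \<phi> B B' \<Phi>"
  shows "B' 1 (\<phi> x) (\<phi> y) + brk L' (\<Phi> 1 x) (\<phi> y) + brk L' (\<phi> x) (\<Phi> 1 y) =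
           \<phi> (B 1 x y) + \<Phi> 1 (brk L x y)"
    and "twist L' (\<Phi> 1 x) = \<Phi> 1 (twist L x)"
proof -
  have def: "deformation L B" "deformation L' B'" and \<Phi>0: "\<Phi> 0 = \<phi>"
    using assms by (auto simp: morphism_deformation_def)
  have lin: "\<Phi> i 0 = 0" for i
    using assms by (auto simp: morphism_deformation_def intro: module_hom.zero)
  have mor: "hom_lie_morphism (fps_hom_lie L B) (fps_hom_lie L' B') (fps_linear_ext \<Phi>)"
    using assms by (simp add: morphism_deformation_def)
  have "fps_bilinear_ext B' (fps_linear_ext \<Phi> (fps_const x)) (fps_linear_ext \<Phi> (fps_const y)) =
      fps_linear_ext \<Phi> (fps_bilinear_ext B (fps_const x) (fps_const y))"
    using mor by (simp add: hom_lie_morphism_def)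
  from arg_cong[OF this, of "\<lambda>f. fps_nth f 1"]
  show "B' 1 (\<phi> x) (\<phi> y) + brk L' (\<Phi> 1 x) (\<phi> y) + brk L' (\<phi> x) (\<Phi> 1 y) =
      \<phi> (B 1 x y) + \<Phi> 1 (brk L x y)"
    by (simp add: fps_linear_ext_def fps_bilinear_ext_def lin algebra_simps
        bilinear_map_zero[OF deformationD(1)[OF def(1)]]
        flip: \<Phi>0 deformationD(2)[OF def(1)] deformationD(2)[OF def(2)])
  have "fps_linear_ext \<Phi> (twist (fps_hom_lie L B) (fps_const x)) =
      twist (fps_hom_lie L' B') (fps_linear_ext \<Phi> (fps_const x))"
    using mor unfolding hom_lie_morphism_def by (metis comp_apply)
  from arg_cong[OF this, of "\<lambda>f. fps_nth f 1"]
  show "twist L' (\<Phi> 1 x) = \<Phi> 1 (twist L x)"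
    by (simp add: fps_linear_ext_def lin deformation_twist_zero[OF def(1)])
qed

text \<open>Supplies the compatibility with the twist that separates \<open>cochains\<close> from
  \<open>skew_multilinear\<close>, by comparing coefficients of t in the multiplicativity of the
  deformed structure.\<close>

lemma multiplicative_brk_1:
  assumes "deformation L B" and "multiplicative (fps_hom_lie L B)"
  shows "twist L (B 1 x y) = B 1 (twist L x) (twist L y)"
proof -
  have "twist (fps_hom_lie L B) (fps_bilinear_ext B (fps_const x) (fps_const y)) =
      fps_bilinear_ext B (twist (fps_hom_lie L B) (fps_const x))
        (twist (fps_hom_lie L B) (fps_const y))"
    using assms(2) by (simp add: multiplicative_def)
  from arg_cong[OF this, of "\<lambda>f. fps_nth f 1"] show ?thesis
    by (simp add: fps_bilinear_ext_def deformation_twist_zero[OF assms(1)]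
        bilinear_map_zero[OF deformationD(1)[OF assms(1)]])
qed

lemma binary_cochain_cochains:
  assumes "deformation L B" and "multiplicative (fps_hom_lie L B)"
  shows "binary_cochain (B 1) \<in> cochains L L 2"
proof -
  have "binary_cochain (B 1) \<in> skew_multilinear L L 2"
    by (rule binary_cochain_skew_multilinear[OF deformationD(1) deformation_brk_1_skew])
      (rule assms(1))+
  then show ?thesis
    using multiplicative_brk_1[OF assms]
    by (auto simp: cochains_def numeral_2_eq_2 length_Suc_conv binary_cochain_def)
qed

text \<open>The cocycle equation holds for every deformation. Membership in the cochain space also
  asks \<open>B 1\<close> and \<open>B' 1\<close> to commute with the twists, which is derived here
  from multiplicativity of the deformed brackets; hence the implication in the last
  conjunct.\<close>

theorem proposition4p11:
  fixes L :: "('k::{alg_closed_field, field_char_0}, 'a::ab_group_add) hom_lie"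
    and L' :: "('k, 'b::ab_group_add) hom_lie"
    and \<phi> :: "'a \<Rightarrow> 'b"
    and B :: "nat \<Rightarrow> 'a \<Rightarrow> 'a \<Rightarrow> 'a"
    and B' :: "nat \<Rightarrow> 'b \<Rightarrow> 'b \<Rightarrow> 'b"
    and \<Phi> :: "nat \<Rightarrow> 'a \<Rightarrow> 'b"
  assumes "hom_lie_algebra L" and "multiplicative L"
    and "hom_lie_algebra L'" and "multiplicative L'"
    and "hom_lie_morphism L L' \<phi>"
    and "morphism_deformation L L' \<phi> B B' \<Phi>"
  shows "infinitesimal B B' \<Phi> \<in>
           skew_multilinear L L 2 \<times> skew_multilinear L' L' 2 \<times> cochains L L' 1
       \<and> morphism_delta L L' \<phi> 2 (infinitesimal B B' \<Phi>) = (\<lambda>_. 0, \<lambda>_. 0, \<lambda>_. 0)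
       \<and> (multiplicative (fps_hom_lie L B) \<and> multiplicative (fps_hom_lie L' B')
            \<longrightarrow> infinitesimal B B' \<Phi> \<in> morphism_cocycles L L' \<phi> 2)"
proof -
  have def: "deformation L B" "deformation L' B'"
    and bil: "bilinear_map (smul L) (B 1)" "bilinear_map (smul L') (B' 1)"
    and lin: "module_hom (smul L) (smul L') (\<Phi> 1)"
    using assms(6) by (auto simp: morphism_deformation_def deformation_def)
  have mod: "module (smul L')" and skew': "brk L' u v = - brk L' v u" for u v
    using hom_lie_algebraD(1,4)[OF assms(3)] by blast+
  have neg: "smul L' (-1) v = - v" for v
    using mod by (simp add: module.scale_minus_left module.scale_one)
  have \<phi>0: "\<phi> 0 = 0"
    using assms(5) by (auto simp: hom_lie_morphism_def intro: module_hom.zero)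
  \<comment> \<open>The scalar -1 is the sign \<open>(-1) ^ (n - 1)\<close> at n = 2.\<close>
  have third: "delta_HL L L' \<phi> 1 (unary_cochain (\<Phi> 1)) xs
      + smul L' (-1) (\<phi> (binary_cochain (B 1) xs) - binary_cochain (B' 1) (map \<phi> xs)) = 0" for xs
  proof (cases "length xs = 2")
    case True
    then obtain x y where xs: "xs = [x, y]"
      by (auto simp: numeral_2_eq_2 length_Suc_conv)
    show ?thesis
      \<comment> \<open>Skew-symmetry turns the second term of the coboundary, with its minus sign,
        into the bracket of \<open>\<Phi> 1 x\<close> with \<open>\<phi> y\<close> found in the
        morphism identity.\<close>
      using morphism_deformation_1(1)[OF assms(6), of x y] skew'[of "\<phi> y" "\<Phi> 1 x"]
      unfolding xs delta_HL_unary_cochain[OF mod] neg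
      by (simp add: binary_cochain_def algebra_simps)
  next
    case False
    then have "binary_cochain (B 1) xs = 0" "binary_cochain (B' 1) (map \<phi> xs) = 0"
      by (auto simp: binary_cochain_def split: list.splits)
    with False show ?thesis
      by (simp add: delta_HL_def neg \<phi>0)
  qed
  have delta: "morphism_delta L L' \<phi> 2 (infinitesimal B B' \<Phi>) = (\<lambda>_. 0, \<lambda>_. 0, \<lambda>_. 0)"
    using third deformation_delta_HL[OF assms(1) def(1)] deformation_delta_HL[OF assms(3) def(2)]
    by (simp add: morphism_delta_def infinitesimal_def)
  have unary: "unary_cochain (\<Phi> 1) \<in> cochains L L' 1"
    using lin morphism_deformation_1(2)[OF assms(6)] by (rule unary_cochain_cochains)
  have "binary_cochain (B 1) \<in> skew_multilinear L L 2"
    "binary_cochain (B' 1) \<in> skew_multilinear L' L' 2"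
    using bil deformation_brk_1_skew[OF def(1)] deformation_brk_1_skew[OF def(2)]
    by (blast intro: binary_cochain_skew_multilinear)+
  with unary delta show ?thesis
    using binary_cochain_cochains[OF def(1)] binary_cochain_cochains[OF def(2)]
    by (simp add: infinitesimal_def morphism_cocycles_def morphism_cochains_def)
qed

end
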